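(* For every finite alphabet $\mathscr{A}$ with at least two elements there exist a sequence $(X_k)_{k=1}^\infty$ of transitive finite shift spaces $X_k\subseteq\mathscr{A}^\infty$ and an ergodic fully supported measure $\mu\in\mathcal{M}^e_\sigma(\mathscr{A}^\infty)$ such that $$\bar d^H_{\mathcal M}(\mathcal{M}_\sigma(X_k),\{\mu\})\to 0\quad\text{as }k\to\infty.$$ In particular, there does not exist a shift space $X\subseteq\mathscr{A}^\infty$ such that $\{\mu\}=\mathcal{M}_\sigma(X)$.
   Context: $\mathscr{A}^\infty$ is the set of sequences $x=(x_i)_{i\ge 0}$ with entries in $\mathscr{A}$, with the product topology; $\sigma(x)_j=x_{j+1}$. A shift space is a nonempty closed set $X\subseteq\mathscr{A}^\infty$ with $\sigma(X)\subseteq X$. $\mathcal{B}(X)$ is the set of all finite words appearing in elements of $X$. $X$ is transitive if for every $u,w\in\mathcal{B}(X)$ there is a word $v$ with $uvw\in\mathcal{B}(X)$. $\mathcal{M}_\sigma(X)$ is the set of $\sigma$-invariant Borel probability measures on $\mathscr{A}^\infty$ with $\mu(X)=1$, and $\mathcal{M}^e_\sigma(X)$ is the subset of ergodic ones. "Fully supported" means every nonempty open subset of $\mathscr{A}^\infty$ has positive measure. Ornstein metric: for $\mu,\nu\in\mathcal{M}_\sigma(\mathscr{A}^\infty)$, $\bar d_{\mathcal M}(\mu,\nu)=\inf_{\xi}\xi(\{(x,y): x_0\neq y_0\})$, the infimum over all $\sigma\times\sigma$-invariant Borel probability measures $\xi$ on $\mathscr{A}^\infty\times\mathscr{A}^\infty$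 with marginals $\mu$ and $\nu$. $\bar d^H_{\mathcal M}(A,B)=\max\{\sup_{a\in A}\inf_{b\in B}\bar d_{\mathcal M}(a,b),\sup_{b\in B}\inf_{a\in A}\bar d_{\mathcal M}(a,b)\}$ is the induced Hausdorff distance. *)

theory Defs
  imports "HOL-Probability.Probability"
begin

text \<open>
  An alphabet is a type of sort \<open>{finite, discrete_topology}\<close>; the space of one-sided
  sequences is \<open>nat \<Rightarrow> 'a\<close>, whose topology (the type class instance for functions) is the product
  topology, and \<open>borel\<close> is its Borel sigma-algebra.
\<close>

definition shift_map :: "(nat \<Rightarrow> 'a) \<Rightarrow> (nat \<Rightarrow> 'a)" where
  "shift_map x = (\<lambda>j. x (j + 1))"

definition shift_space :: "(nat \<Rightarrow> 'a::topological_space) set \<Rightarrow> bool" where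
  "shift_space X \<longleftrightarrow> X \<noteq> {} \<and> closed X \<and> shift_map ` X \<subseteq> X"

definition language :: "(nat \<Rightarrow> 'a) set \<Rightarrow> 'a list set" where
  "language X = {w. \<exists>x\<in>X. \<exists>i. w = map x [i..<i + length w]}"

definition transitive_shift :: "(nat \<Rightarrow> 'a) set \<Rightarrow> bool" where
  "transitive_shift X \<longleftrightarrow>
     (\<forall>u\<in>language X. \<forall>w\<in>language X. \<exists>v. u @ v @ w \<in> language X)"

definition invariant_measures ::
    "(nat \<Rightarrow> 'a::topological_space) set \<Rightarrow> (nat \<Rightarrow> 'a) measure set" where
  "invariant_measures X =
     {\<mu>. prob_space \<mu> \<and> sets \<mu> = sets borel \<and> distr \<mu> borel shift_map = \<mu> \<and> emeasure \<mu> X = 1}"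

definition ergodic_measures ::
    "(nat \<Rightarrow> 'a::topological_space) set \<Rightarrow> (nat \<Rightarrow> 'a) measure set" where
  "ergodic_measures X =
     {\<mu> \<in> invariant_measures X.
        \<forall>B\<in>sets borel. shift_map -` B = B \<longrightarrow> emeasure \<mu> B = 0 \<or> emeasure \<mu> B = 1}"

definition fully_supported :: "(nat \<Rightarrow> 'a::topological_space) measure \<Rightarrow> bool" where
  "fully_supported \<mu> \<longleftrightarrow> (\<forall>U. open U \<and> U \<noteq> {} \<longrightarrow> emeasure \<mu> U > 0)"

definition joinings ::
    "(nat \<Rightarrow> 'a::topological_space) measure \<Rightarrow> (nat \<Rightarrow> 'a) measure \<Rightarrow>
     ((nat \<Rightarrow> 'a) \<times> (nat \<Rightarrow> 'a)) measure set" where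
  "joinings \<mu> \<nu> =
     {\<xi>. prob_space \<xi> \<and> sets \<xi> = sets borel \<and>
         distr \<xi> borel (map_prod shift_map shift_map) = \<xi> \<and>
         distr \<xi> borel fst = \<mu> \<and> distr \<xi> borel snd = \<nu>}"

text \<open>
  The metric and its Hausdorff distance are \<open>ennreal\<close>-valued, so that all infima and suprema
  are taken in a complete lattice. On invariant measures the values lie in the unit interval.
\<close>

definition dbar ::
    "(nat \<Rightarrow> 'a::topological_space) measure \<Rightarrow> (nat \<Rightarrow> 'a) measure \<Rightarrow> ennreal" where
  "dbar \<mu> \<nu> = (INF \<xi>\<in>joinings \<mu> \<nu>. emeasure \<xi> {(x, y). x 0 \<noteq> y 0})"

definition dbar_Hausdorff ::
    "(nat \<Rightarrow> 'a::topological_space) measure set \<Rightarrow> (nat \<Rightarrow> 'a) measure set \<Rightarrow> ennreal" where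
  "dbar_Hausdorff A B =
     max (SUP a\<in>A. INF b\<in>B. dbar a b) (SUP b\<in>B. INF a\<in>A. dbar a b)"

end

theory Submission
  imports Defs
begin

text \<open>
  The measure \<open>\<mu>\<close> is a factor of the 2-adic odometer, and the periodic measures approximating it
  are factors of the same odometer through codings that see only finitely many digits. A coding is
  a map \<open>s\<close> from fair coin sequences (2-adic integers) to the alphabet; reading \<open>s\<close> along the
  odometer orbit of a random point gives a stationary process \<open>coding_measure s\<close>. Everything the
  theorem asks for becomes a statement about \<open>s\<close>:

  \<^item> The process is ergodic, because the odometer is. An odometer-invariant set meets all residue
    classes modulo \<open>2 ^ n\<close> in equal measure, hence is independent of every cylinder, hence of
    itself (\<open>odometer_ergodic\<close>).

  \<^item> If \<open>s\<close> depends only on the residue modulo \<open>2 ^ n\<close>, then every sample path lies on one periodic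
    orbit, and a periodic orbit carries only one invariant measure
    (\<open>invariant_measure_orbit_unique\<close>).

  \<^item> Reading two codings \<open>s\<close> and \<open>t\<close> along the same orbit is a joining, so the distance of the two
    processes is at most the probability that \<open>s \<noteq> t\<close> (\<open>dbar_coding_le\<close>). Thus convergence of
    codings in probability suffices.

  It remains to choose codings. Let \<open>W\<close> enumerate all words. At stage \<open>k\<close> the word \<open>W k\<close> is written
  over the places whose residue modulo \<open>2 ^ level W k\<close> is below the length of \<open>W k\<close>. The levels grow
  so fast that almost every place is rewritten finitely often, which yields a limit coding, and
  so fast that with positive probability the whole copy of \<open>W k\<close> starting at residue \<open>0\<close> survives all
  later stages (\<open>limit_symbol_word_probability\<close>); this makes the limit fully supported.

  Finally, a closed set of full measure for a fully supported measure is the whole sequence space,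
  which also carries the point mass at a constant sequence, so \<open>\<mu>\<close> cannot be the only invariant
  measure of a shift space.
\<close>

section \<open>Cylinders and Borel sets of sequences\<close>

lemma open_contains_cylinder:
  fixes U :: "(nat \<Rightarrow> 'b::topological_space) set"
  assumes "open U" "x \<in> U"
  obtains n where "{y. \<forall>i<n. y i = x i} \<subseteq> U"
proof -
  obtain X where X: "x \<in> (\<Pi>\<^sub>E i\<in>UNIV. X i)" "finite {i. X i \<noteq> UNIV}" "(\<Pi>\<^sub>E i\<in>UNIV. X i) \<subseteq> U"
    using product_topology_open_contains_basis[of "\<lambda>_. euclidean" UNIV U x] assms
    unfolding open_fun_def by auto
  obtain n where n: "\<forall>i\<in>{i. X i \<noteq> UNIV}. i < n"
    using X(2) finite_nat_set_iff_bounded by blast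
  have "{y. \<forall>i<n. y i = x i} \<subseteq> (\<Pi>\<^sub>E i\<in>UNIV. X i)"
  proof
    fix y assume y: "y \<in> {y. \<forall>i<n. y i = x i}"
    have "y i \<in> X i" for i
      using n X(1) y by (cases "i < n") (auto simp: PiE_iff)
    then show "y \<in> (\<Pi>\<^sub>E i\<in>UNIV. X i)" by auto
  qed
  with X(3) show ?thesis by (intro that) blast
qed

lemma open_pair_contains_cylinder:
  fixes U :: "((nat \<Rightarrow> 'b::topological_space) \<times> (nat \<Rightarrow> 'c::topological_space)) set"
  assumes "open U" "(x, z) \<in> U"
  obtains n where "{y. \<forall>i<n. y i = x i} \<times> {y. \<forall>i<n. y i = z i} \<subseteq> U"
proof -
  obtain V W where VW: "open V" "open W" "x \<in> V" "z \<in> W" "V \<times> W \<subseteq> U"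
    by (rule open_prod_elim[OF assms]) auto
  obtain n where n: "{y. \<forall>i<n. y i = x i} \<subseteq> V"
    by (rule open_contains_cylinder[OF VW(1,3)])
  obtain m where m: "{y. \<forall>i<m. y i = z i} \<subseteq> W"
    by (rule open_contains_cylinder[OF VW(2,4)])
  have "{y. \<forall>i<max n m. y i = x i} \<times> {y. \<forall>i<max n m. y i = z i} \<subseteq> U"
  proof (rule subset_trans[OF Sigma_mono])
    show "{y. \<forall>i<max n m. y i = x i} \<subseteq> V" using n by (auto simp: less_max_iff_disj subset_iff)
    show "{y. \<forall>i<max n m. y i = z i} \<subseteq> W" using m by (auto simp: less_max_iff_disj subset_iff)
  qed (rule VW(5))
  then show ?thesis by (rule that)
qed

text \<open>
  Open sets of pairs are unions of products of cylinders, and there are only countably many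
  cylinders; so coordinatewise measurability controls the Borel sets. This covers joint codings
  and, with a projection, single ones.
\<close>
lemma measurable_pair_of_sequences:
  fixes g :: "'w \<Rightarrow> nat \<Rightarrow> 'b::{finite,discrete_topology}"
    and h :: "'w \<Rightarrow> nat \<Rightarrow> 'c::{finite,discrete_topology}"
  assumes [measurable]: "\<And>i. (\<lambda>w. g w i) \<in> measurable M (count_space UNIV)"
    "\<And>i. (\<lambda>w. h w i) \<in> measurable M (count_space UNIV)"
  shows "(\<lambda>w. (g w, h w)) \<in> borel_measurable M"
proof (rule borel_measurableI)
  fix U :: "((nat \<Rightarrow> 'b) \<times> (nat \<Rightarrow> 'c)) set" assume "open U"
  define C where "C = (\<lambda>(u, v). {y::nat\<Rightarrow>'b. \<forall>i<length u. y i = u ! i} \<times> {y::nat\<Rightarrow>'c. \<forall>i<length v. y i = v ! i})"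
  have U: "U = \<Union> (C ` {p. C p \<subseteq> U})"
  proof (intro equalityI subsetI)
    fix p assume p: "p \<in> U"
    obtain x z where xz: "p = (x, z)" by (cases p)
    obtain n where n: "{y. \<forall>i<n. y i = x i} \<times> {y. \<forall>i<n. y i = z i} \<subseteq> U"
      by (rule open_pair_contains_cylinder[OF \<open>open U\<close> p[unfolded xz]])
    have "C (map x [0..<n], map z [0..<n]) = {y. \<forall>i<n. y i = x i} \<times> {y. \<forall>i<n. y i = z i}"
      by (auto simp: C_def)
    then show "p \<in> \<Union> (C ` {p. C p \<subseteq> U})" using n xz by blast
  qed auto
  have meas: "(\<lambda>w. (g w, h w)) -` C p \<inter> space M \<in> sets M" for p
  proof -
    have "(\<lambda>w. (g w, h w)) -` C p \<inter> space M =
      {w \<in> space M. (\<forall>i<length (fst p). g w i = fst p ! i) \<and> (\<forall>i<length (snd p). h w i = snd p ! i)}"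
      by (auto simp: C_def split: prod.splits)
    also have "\<dots> \<in> sets M" by measurable
    finally show ?thesis .
  qed
  have "(\<lambda>w. (g w, h w)) -` U \<inter> space M = (\<Union>p\<in>{p. C p \<subseteq> U}. (\<lambda>w. (g w, h w)) -` C p \<inter> space M)"
    by (subst U) auto
  also have "\<dots> \<in> sets M"
    using meas by (intro sets.countable_UN'') auto
  finally show "(\<lambda>w. (g w, h w)) -` U \<inter> space M \<in> sets M" .
qed

lemma borel_measurable_fst: "fst \<in> borel_measurable (borel :: ('b::topological_space \<times> 'c::topological_space) measure)"
  by (rule borel_measurable_continuous_onI, rule continuous_on_fst[OF continuous_on_id, simplified])

lemma borel_measurable_snd: "snd \<in> borel_measurable (borel :: ('b::topological_space \<times> 'c::topological_space) measure)"
  by (rule borel_measurable_continuous_onI, rule continuous_on_snd[OF continuous_on_id, simplified])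

lemma continuous_shift_map: "continuous_on UNIV (shift_map :: (nat \<Rightarrow> 'b::topological_space) \<Rightarrow> _)"
  unfolding shift_map_def by (intro continuous_on_coordinatewise_then_product) simp

lemma measurable_shift_map [measurable]:
  "shift_map \<in> measurable borel (borel :: (nat \<Rightarrow> 'b::topological_space) measure)"
  by (intro borel_measurable_continuous_onI continuous_shift_map)

lemma measurable_shift_map_pair [measurable]:
  "map_prod shift_map shift_map \<in> measurable borel (borel :: ((nat \<Rightarrow> 'b::topological_space) \<times> (nat \<Rightarrow> 'c::topological_space)) measure)"
proof (rule borel_measurable_continuous_onI)
  have "continuous_on UNIV (\<lambda>p::(nat \<Rightarrow> 'b) \<times> (nat \<Rightarrow> 'c). (shift_map (fst p), shift_map (snd p)))"
  proof (rule continuous_on_Pair)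
    show "continuous_on UNIV (\<lambda>p::(nat \<Rightarrow> 'b) \<times> (nat \<Rightarrow> 'c). shift_map (fst p))"
      by (rule continuous_on_compose2[OF continuous_shift_map continuous_on_fst[OF continuous_on_id]]) simp
    show "continuous_on UNIV (\<lambda>p::(nat \<Rightarrow> 'b) \<times> (nat \<Rightarrow> 'c). shift_map (snd p))"
      by (rule continuous_on_compose2[OF continuous_shift_map continuous_on_snd[OF continuous_on_id]]) simp
  qed
  then show "continuous_on UNIV (map_prod shift_map shift_map :: (nat \<Rightarrow> 'b) \<times> (nat \<Rightarrow> 'c) \<Rightarrow> _)"
    by (simp add: map_prod_def case_prod_unfold)
qed

lemma open_first_symbol:
  fixes A :: "'b::discrete_topology set"
  shows "open {x::nat \<Rightarrow> 'b. x 0 \<in> A}"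
proof -
  have "open A" by (rule discrete_topology_class.open_discrete)
  then show ?thesis
    using product_topology_basis'[of "{0::nat}" "\<lambda>i. A" "\<lambda>i. i"] by simp
qed

lemma borel_first_symbols_differ:
  "{(x, y). x 0 \<noteq> y 0} \<in> sets (borel :: ((nat \<Rightarrow> 'b::discrete_topology) \<times> (nat \<Rightarrow> 'b)) measure)"
proof (rule borel_open)
  have "{(x::nat\<Rightarrow>'b, y::nat \<Rightarrow> 'b). x 0 \<noteq> y 0} = (\<Union>a. {x. x 0 = a} \<times> {y. y 0 \<noteq> a})"
    by auto
  moreover have "open {x::nat\<Rightarrow>'b. x 0 = a}" "open {x::nat\<Rightarrow>'b. x 0 \<noteq> a}" for a
    using open_first_symbol[of "{a}"] open_first_symbol[of "- {a}"] by auto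
  ultimately show "open {(x::nat\<Rightarrow>'b, y::nat \<Rightarrow> 'b). x 0 \<noteq> y 0}"
    by (simp add: open_UN open_Times)
qed

section \<open>Periodic orbits\<close>

lemma closed_singleton_sequence: "closed {x :: nat \<Rightarrow> 'b::t1_space}"
proof -
  have "{x} = (\<Inter>i. {y. y i = x i})" by auto
  moreover have "closed {y::nat \<Rightarrow> 'b. y i = x i}" for i
    using closed_vimage[OF closed_singleton[of "x i"] continuous_on_product_coordinates[of i]]
    by (simp add: vimage_def)
  ultimately show ?thesis by (auto intro: closed_INT)
qed

lemma finite_imp_closed_sequences:
  fixes A :: "(nat \<Rightarrow> 'b::t1_space) set"
  assumes "finite A"
  shows "closed A"
  using assms by induction (use closed_Un[OF closed_singleton_sequence] in auto)

definition orbit :: "(nat \<Rightarrow> 'b) \<Rightarrow> (nat \<Rightarrow> 'b) set" where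
  "orbit x = range (\<lambda>i n. x (n + i))"

lemma periodic_mod:
  fixes x :: "nat \<Rightarrow> 'b"
  assumes "\<And>n. x (n + p) = x n"
  shows "x (n mod p) = x n"
proof -
  have *: "x (m + k * p) = x m" for m k
    by (induction k) (use assms in \<open>auto simp: add.assoc[symmetric] add.commute[of p]\<close>)
  show ?thesis using *[of "n mod p" "n div p"] by simp
qed

lemma finite_orbit:
  assumes "\<And>n. x (n + p) = x n" "p > 0"
  shows "finite (orbit x)"
proof -
  have "orbit x \<subseteq> (\<lambda>i n. x (n + i)) ` {..<p}"
  proof
    fix y assume "y \<in> orbit x"
    then obtain i where i: "y = (\<lambda>n. x (n + i))" by (auto simp: orbit_def)
    have "x (n + i) = x (n + i mod p)" for n
      using periodic_mod[of x p, OF assms(1)] by (metis mod_add_right_eq)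
    then have "y = (\<lambda>n. x (n + i mod p))" by (simp add: i)
    then show "y \<in> (\<lambda>i n. x (n + i)) ` {..<p}" using assms(2) by auto
  qed
  then show ?thesis by (rule finite_subset) simp
qed

lemma shift_space_orbit:
  fixes x :: "nat \<Rightarrow> 'b::discrete_topology"
  assumes "\<And>n. x (n + p) = x n" "p > 0"
  shows "shift_space (orbit x)"
  unfolding shift_space_def
proof (intro conjI)
  show "closed (orbit x)" by (rule finite_imp_closed_sequences, rule finite_orbit[of x p, OF assms])
  show "shift_map ` orbit x \<subseteq> orbit x"
  proof (clarsimp simp: orbit_def shift_map_def)
    fix i show "(\<lambda>j. x (Suc (j + i))) \<in> range (\<lambda>i n. x (n + i))"
      by (rule image_eqI[of _ _ "Suc i"]) auto
  qed
qed (auto simp: orbit_def)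

text \<open>
  Shifting the occurrence of the second word by a multiple of the period puts it to the right of the
  first one.
\<close>
lemma transitive_orbit:
  fixes x :: "nat \<Rightarrow> 'b"
  assumes per: "\<And>n. x (n + p) = x n" and "p > 0"
  shows "transitive_shift (orbit x)"
proof -
  have lang: "w \<in> language (orbit x) \<longleftrightarrow> (\<exists>i. w = map x [i..<i + length w])" for w
  proof
    assume "w \<in> language (orbit x)"
    then obtain j i where w: "w = map (\<lambda>n. x (n + j)) [i..<i + length w]"
      by (auto simp: language_def orbit_def)
    have "map (\<lambda>n. x (n + j)) [i..<i + length w] = map x [i + j..<i + j + length w]"
      by (rule nth_equalityI) (auto simp: ac_simps)
    then show "\<exists>i. w = map x [i..<i + length w]" using w by metis
  next
    assume "\<exists>i. w = map x [i..<i + length w]"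
    moreover have "x \<in> orbit x" unfolding orbit_def by (rule image_eqI[of _ _ 0]) auto
    ultimately show "w \<in> language (orbit x)" unfolding language_def by blast
  qed
  show ?thesis unfolding transitive_shift_def
  proof (intro ballI)
    fix u w assume "u \<in> language (orbit x)" "w \<in> language (orbit x)"
    then obtain i j where u: "u = map x [i..<i + length u]" and w: "w = map x [j..<j + length w]"
      unfolding lang by blast
    define k where "k = j + (i + length u) * p"
    have ik: "i + length u \<le> k" using \<open>p > 0\<close> by (simp add: k_def trans_le_add2)
    have "x (k + n) = x (j + n)" for n
      using periodic_mod[of x p, OF per, of "k + n"] periodic_mod[of x p, OF per, of "j + n"]
      by (metis add.commute add.left_commute k_def mod_mult_self1)
    then have w': "w = map x [k..<k + length w]"
      by (subst w, intro nth_equalityI) auto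
    define v where "v = map x [i + length u..<k]"
    have "u @ v @ w = map x ([i..<i + length u] @ [i + length u..<k] @ [k..<k + length w])"
      using u w' by (simp add: v_def)
    also have "[i..<i + length u] @ [i + length u..<k] @ [k..<k + length w] = [i..<k + length w]"
      using ik by (metis le_add1 le_add_diff_inverse upt_add_eq_append le_trans)
    also have "k + length w = i + length (u @ v @ w)"
      using ik by (simp add: v_def)
    finally show "\<exists>v. u @ v @ w \<in> language (orbit x)" unfolding lang by blast
  qed
qed

text \<open>
  The shift permutes a periodic orbit cyclically, so an invariant measure gives all its points the
  same mass.
\<close>
lemma invariant_measure_orbit_eq:
  fixes x :: "nat \<Rightarrow> 'b::discrete_topology"
  assumes per: "\<And>n. x (n + p) = x n" and p: "p > 0" and \<nu>: "\<nu> \<in> invariant_measures (orbit x)"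
    and B: "B \<in> sets borel"
  shows "measure \<nu> B = card (B \<inter> orbit x) / card (orbit x)"
proof -
  interpret prob_space \<nu> using \<nu> by (simp add: invariant_measures_def)
  have sets [measurable_cong, simp]: "sets \<nu> = sets borel" and inv: "distr \<nu> borel shift_map = \<nu>" and "emeasure \<nu> (orbit x) = 1"
    using \<nu> by (auto simp: invariant_measures_def)
  then have full: "prob (orbit x) = 1" by (simp add: measure_def)
  have fin: "finite (orbit x)" by (rule finite_orbit[of x p, OF per p])
  then have bor: "A \<in> sets borel" if "A \<subseteq> orbit x" for A
    using that by (meson finite_subset finite_imp_closed_sequences borel_closed)
  define r where "r i = (\<lambda>n. x (n + i))" for i
  have [simp]: "{y} \<in> sets borel" for y :: "nat \<Rightarrow> 'b"
    by (rule borel_closed closed_singleton_sequence)+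
  have [simp]: "space \<nu> = UNIV" using sets_eq_imp_space_eq[OF sets] by simp
  have ae: "AE y in \<nu>. y \<in> orbit x"
    using full prob_eq_1[of "orbit x"] bor[of "orbit x"] by simp
  have shift_r: "shift_map (r i) = r (Suc i)" for i by (simp add: r_def shift_map_def)
\<comment> \<open>The shift is injective on the orbit: a point is recovered from its shift by one further period.\<close>
  have inj: "y = r i" if y: "y \<in> orbit x" "shift_map y = r (Suc i)" for y i
  proof
    fix n
    obtain j where j: "y = (\<lambda>n. x (n + j))" using y(1) unfolding orbit_def by blast
    obtain q where q: "p = Suc q" using p by (cases p) auto
    have "y n = y (n + p)" using per[of "n + j"] by (simp add: j add.commute add.left_commute)
    also have "\<dots> = shift_map y (n + q)" by (simp add: shift_map_def q)
    also have "\<dots> = x (n + q + Suc i)" using y(2) by (simp add: r_def)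
    also have "\<dots> = x (n + i)" using per[of "n + i"] by (simp add: q add.commute add.left_commute)
    finally show "y n = r i n" by (simp add: r_def)
  qed
  have "prob {r (Suc i)} = prob {r i}" for i
  proof -
    have "prob {r (Suc i)} = measure (distr \<nu> borel shift_map) {r (Suc i)}" by (simp add: inv)
    also have "\<dots> = prob (shift_map -` {r (Suc i)} \<inter> space \<nu>)"
      by (rule measure_distr) auto
    also have "\<dots> = prob {r i}"
    proof (rule finite_measure_eq_AE)
      show "AE y in \<nu>. (y \<in> shift_map -` {r (Suc i)} \<inter> space \<nu>) = (y \<in> {r i})"
        using ae by eventually_elim (use inj shift_r in auto)
      show "shift_map -` {r (Suc i)} \<inter> space \<nu> \<in> events"
        by (rule measurable_sets[of _ _ borel]) auto
    qed auto
    finally show ?thesis .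
  qed
  then have "prob {r i} = prob {r 0}" for i by (induction i) auto
  then have eq: "prob {y} = prob {r 0}" if "y \<in> orbit x" for y
    using that unfolding orbit_def r_def[symmetric] by auto
  have count: "prob A = card A * prob {r 0}" if "A \<subseteq> orbit x" for A
  proof -
    have "prob A = (\<Sum>y\<in>A. prob {y})"
      by (rule finite_measure_eq_sum_singleton) (use that fin finite_subset in auto)
    also have "\<dots> = (\<Sum>y\<in>A. prob {r 0})" using eq that by (intro sum.cong) auto
    finally show ?thesis by simp
  qed
  have "card (orbit x) * prob {r 0} = 1" using count[of "orbit x"] full by simp
  then have "prob {r 0} = 1 / card (orbit x)" by (metis mult_zero_left nonzero_eq_divide_eq mult.commute zero_neq_one)
  moreover have "prob B = prob (B \<inter> orbit x)"
    by (rule finite_measure_eq_AE) (use ae B bor[of "orbit x"] in auto)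
  ultimately show ?thesis using count[of "B \<inter> orbit x"] by simp
qed

lemma invariant_measure_orbit_unique:
  fixes x :: "nat \<Rightarrow> 'b::discrete_topology"
  assumes "\<And>n. x (n + p) = x n" "p > 0"
    and "\<nu> \<in> invariant_measures (orbit x)" "\<nu>' \<in> invariant_measures (orbit x)"
  shows "\<nu> = \<nu>'"
proof (rule measure_eqI)
  have s: "sets \<nu> = sets borel" "sets \<nu>' = sets borel" "prob_space \<nu>" "prob_space \<nu>'"
    using assms(3,4) by (auto simp: invariant_measures_def)
  then show "sets \<nu> = sets \<nu>'" by simp
  fix B assume "B \<in> sets \<nu>"
  then have "measure \<nu> B = measure \<nu>' B"
    using invariant_measure_orbit_eq[of x p, OF assms(1,2)] assms(3,4) s(1) by simp
  then show "emeasure \<nu> B = emeasure \<nu>' B"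
    using s by (simp add: finite_measure.emeasure_eq_measure prob_space.finite_measure)
qed

section \<open>The 2-adic odometer\<close>

text \<open>
  A sequence of bits is read as a 2-adic integer, lowest digit first; this is its residue modulo
  \<open>2 ^ n\<close>.
\<close>
definition residue :: "nat \<Rightarrow> (nat \<Rightarrow> bool) \<Rightarrow> nat" where
  "residue n w = horner_sum of_bool 2 (map w [0..<n])"

text \<open>
  Adding \<open>1\<close> with carry flips exactly those digits below which all digits are set.
\<close>
definition odometer :: "(nat \<Rightarrow> bool) \<Rightarrow> (nat \<Rightarrow> bool)" where
  "odometer w = (\<lambda>i. w i \<noteq> (\<forall>j<i. w j))"

definition coins :: "(nat \<Rightarrow> bool) measure" where
  "coins = PiM UNIV (\<lambda>_. uniform_count_measure UNIV)"

lemma residue_0 [simp]: "residue 0 w = 0"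
  by (simp add: residue_def)

lemma residue_Suc: "residue (Suc n) w = residue n w + 2 ^ n * of_bool (w n)"
  by (simp add: residue_def horner_sum_append)

lemma bit_residue: "bit (residue n w) i \<longleftrightarrow> i < n \<and> w i"
  by (auto simp: residue_def bit_horner_sum_bit_iff)

lemma residue_mod:
  assumes "m \<le> n"
  shows "residue n w mod 2 ^ m = residue m w"
  using assms
  by (auto intro!: bit_eqI simp: bit_residue bit_take_bit_iff simp flip: take_bit_eq_mod)

lemma residue_less: "residue n w < 2 ^ n"
  using residue_mod[of n n w] by (metis mod_less_divisor order_refl zero_less_numeral zero_less_power)

lemma residue_eq_iff:
  assumes "r < 2 ^ n"
  shows "residue n w = r \<longleftrightarrow> (\<forall>i<n. w i = bit r i)"
proof
  assume r: "\<forall>i<n. w i = bit r i"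
  have "take_bit n r = r" using assms by (simp add: take_bit_nat_eq_self)
  then have "bit r i \<Longrightarrow> i < n" for i by (metis bit_take_bit_iff)
  then show "residue n w = r" using r by (auto intro!: bit_eqI simp: bit_residue)
qed (auto simp: bit_residue)

lemma all_ones_iff: "(\<forall>i<n. w i) \<longleftrightarrow> residue n w + 1 = 2 ^ n"
proof -
  have "residue n w = mask n \<longleftrightarrow> (\<forall>i<n. w i)"
    using residue_eq_iff[OF mask_nat_less_exp, of n w] by (simp add: bit_mask_iff)
  moreover have "residue n w = mask n \<longleftrightarrow> residue n w + 1 = 2 ^ n"
    using residue_less[of n w] by (auto simp: mask_eq_exp_minus_1)
  ultimately show ?thesis by simp
qed

text \<open>
  The carry enters digit \<open>n\<close> exactly when the residue modulo \<open>2 ^ n\<close> wraps around to \<open>0\<close>.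
\<close>
lemma residue_odometer: "residue n (odometer w) = (residue n w + 1) mod 2 ^ n"
proof (induction n)
  case (Suc n)
  consider "residue n w + 1 = 2 ^ n" | "residue n w + 1 < 2 ^ n"
    using residue_less[of n w] by linarith
  then show ?case
  proof cases
    case 1
    then have "odometer w n \<longleftrightarrow> \<not> w n" by (simp add: odometer_def all_ones_iff)
    moreover have "Suc (residue n w + 2 ^ n) = 2 * 2 ^ n" using 1 by simp
    then have "Suc (residue n w + 2 ^ n) mod (2 * 2 ^ n) = 0" by (metis mod_self)
    ultimately show ?thesis using 1 Suc by (simp add: residue_Suc)
  next
    case 2
    then have "odometer w n \<longleftrightarrow> w n" by (simp add: odometer_def all_ones_iff)
    with 2 Suc show ?thesis by (simp add: residue_Suc)
  qed
qed simp

lemma residue_odometer_funpow: "residue n ((odometer ^^ k) w) = (residue n w + k) mod 2 ^ n"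
proof (induction k)
  case 0
  show ?case using residue_less by simp
next
  case (Suc k)
  then show ?case by (simp add: residue_odometer mod_Suc_eq)
qed

lemma space_coins [simp]: "space coins = UNIV"
  by (simp add: coins_def space_PiM space_uniform_count_measure)

lemma sets_coins [measurable_cong]: "sets coins = sets (PiM UNIV (\<lambda>_. count_space UNIV))"
  unfolding coins_def by (intro sets_PiM_cong) (simp_all add: sets_uniform_count_measure_count_space)

lemma prob_space_coins: "prob_space coins"
  unfolding coins_def by (intro prob_space_PiM prob_space_uniform_count_measure) auto

lemma measurable_bit [measurable]: "(\<lambda>w. w i) \<in> measurable coins (count_space UNIV)"
  by measurable

lemma measurable_residue [measurable]: "residue n \<in> measurable coins (count_space UNIV)"
proof (induction n)
  case (Suc n)
  note Suc [measurable]
  show ?case unfolding residue_Suc by measurable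
qed simp

lemma residue_set [measurable]: "{w. residue n w = r} \<in> sets coins"
proof -
  have "{w \<in> space coins. residue n w = r} \<in> sets coins" by measurable
  then show ?thesis by simp
qed

lemma measurable_odometer [measurable]: "odometer \<in> measurable coins coins"
proof -
  have "odometer \<in> measurable coins (PiM UNIV (\<lambda>_. count_space UNIV))"
    unfolding odometer_def by (rule measurable_PiM_single') (auto, measurable)
  then show ?thesis using measurable_cong_sets[OF refl sets_coins] by blast
qed

lemma measure_residue:
  assumes "r < 2 ^ n"
  shows "measure coins {w. residue n w = r} = 1 / 2 ^ n"
proof -
  interpret product_prob_space "\<lambda>_::nat. uniform_count_measure (UNIV :: bool set)" UNIV
    by (intro product_prob_spaceI prob_space_uniform_count_measure) auto
  have "{w. residue n w = r} = {w \<in> space coins. \<forall>i\<in>{..<n}. w i \<in> {bit r i}}"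
    by (auto simp: residue_eq_iff[OF assms])
  then have "emeasure coins {w. residue n w = r}
     = (\<Prod>i\<in>{..<n}. emeasure (uniform_count_measure (UNIV :: bool set)) {bit r i})"
    using emeasure_PiM_Collect[of "{..<n}" "\<lambda>i. {bit r i}"]
    by (simp add: sets_uniform_count_measure flip: coins_def)
  also have "\<dots> = (\<Prod>i\<in>{..<n}. ennreal (1 / 2))"
    by (simp add: emeasure_uniform_count_measure)
  also have "\<dots> = ennreal (1 / 2 ^ n)"
    unfolding prod_constant card_lessThan by (subst ennreal_power) (simp_all add: power_one_over)
  finally show ?thesis by (simp add: measure_def)
qed

lemma sets_coins_generated:
  "sets coins = sigma_sets UNIV (range (\<lambda>(n, r). {w. residue n w = r}))" (is "_ = sigma_sets UNIV ?E")
proof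
  show "sigma_sets UNIV ?E \<subseteq> sets coins"
    using sets.sigma_sets_subset[of ?E coins] residue_set by (simp add: image_subset_iff split_beta)
next
  let ?S = "sigma UNIV ?E"
  have sS: "sets ?S = sigma_sets UNIV ?E" "space ?S = UNIV" by simp_all
  have E: "{w. residue n w = r} \<in> sigma_sets UNIV ?E" for n r
    by (rule sigma_sets.Basic, rule image_eqI[of _ _ "(n, r)"]) simp_all
  have "(\<lambda>w. w) \<in> measurable ?S (PiM UNIV (\<lambda>_. count_space UNIV))"
  proof (rule measurable_PiM_single'[where f = "\<lambda>i w. w i"])
    fix i :: nat
    show "(\<lambda>w. w i) \<in> measurable ?S (count_space UNIV)"
    proof (rule measurableI)
      fix B :: "bool set"
      have "(\<lambda>w. w i) -` B \<inter> space ?S = (\<Union>r\<in>{r. bit r i \<in> B}. {w. residue (Suc i) w = r})"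
        unfolding sS by (rule set_eqI) (simp add: bit_residue)
      also have "\<dots> \<in> sets ?S"
        by (intro sets.countable_UN'') (simp_all only: sS(1) E countableI_type)
      finally show "(\<lambda>w. w i) -` B \<inter> space ?S \<in> sets ?S" .
    qed simp
  qed auto
  note id = this
  show "sets coins \<subseteq> sigma_sets UNIV ?E"
  proof
    fix A assume "A \<in> sets coins"
    then have "(\<lambda>w. w) -` A \<inter> space ?S \<in> sets ?S"
      unfolding sets_coins by (rule measurable_sets[OF id])
    then show "A \<in> sigma_sets UNIV ?E" unfolding sS by simp
  qed
qed

lemma Int_stable_residue: "Int_stable (insert {} (range (\<lambda>(n, r). {w. residue n w = r})))"
proof -
  let ?E = "insert {} (range (\<lambda>(n, r). {w. residue n w = r}))"
  have mem: "{w. residue n w = r} \<in> ?E" for n r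
    by (rule insertI2, rule image_eqI[of _ _ "(n, r)"]) simp_all
  have le: "{w. residue n w = r} \<inter> {w. residue m w = s} \<in> ?E" if "n \<le> m" for n m r s
  proof (cases "s mod 2 ^ n = r")
    case True
    then have "{w. residue n w = r} \<inter> {w. residue m w = s} = {w. residue m w = s}"
      by (auto simp: residue_mod[OF that, symmetric])
    then show ?thesis using mem by metis
  next
    case False
    then have "{w. residue n w = r} \<inter> {w. residue m w = s} = {}"
      by (auto simp: residue_mod[OF that, symmetric])
    then show ?thesis by simp
  qed
  have "{w. residue n w = r} \<inter> {w. residue m w = s} \<in> ?E" for n m r s
    using le[of n m r s] le[of m n s r] by (metis Int_commute nat_le_linear)
  then show ?thesis
    by (intro Int_stableI) (elim insertE imageE; simp add: split_beta)
qed

text \<open>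
  Residue classes modulo powers of two are either nested or disjoint, so they form a generator
  closed under intersection, up to the empty set.
\<close>
lemma measure_eqI_residue:
  assumes M: "finite_measure M" "sets M = sets coins" and N: "finite_measure N" "sets N = sets coins"
    and eq: "\<And>n r. r < 2 ^ n \<Longrightarrow> measure M {w. residue n w = r} = measure N {w. residue n w = r}"
  shows "M = N"
proof -
  define E where "E = insert {} (range (\<lambda>(n, r). {w. residue n w = r}))"
  have "sigma_sets UNIV E = sigma_sets UNIV (range (\<lambda>(n, r). {w. residue n w = r}))"
    unfolding E_def by (rule sigma_sets_eqI) (blast intro: sigma_sets.intros)+
  then have sets: "sets M = sigma_sets UNIV E" "sets N = sigma_sets UNIV E"
    using M N sets_coins_generated by auto
  have UNIV: "UNIV \<in> E" by (auto simp: E_def intro!: image_eqI[of _ _ "(0, 0)"])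
  show ?thesis
  proof (rule measure_eqI_generator_eq[where E = E and \<Omega> = UNIV and A = "\<lambda>_. UNIV"])
    fix X assume "X \<in> E"
    then consider "X = {}" | n r where "X = {w. residue n w = r}" by (auto simp: E_def)
    then show "emeasure M X = emeasure N X"
    proof cases
      case (2 n r)
      show ?thesis
      proof (cases "r < 2 ^ n")
        case True
        then show ?thesis using eq 2 M(1) N(1) by (simp add: finite_measure.emeasure_eq_measure)
      next
        case False
        then have "X = {}" using residue_less 2 by auto
        then show ?thesis by simp
      qed
    qed simp
  qed (use sets UNIV M(1) Int_stable_residue in \<open>auto simp: E_def finite_measure.emeasure_finite\<close>)
qed

lemma distr_odometer: "distr coins coins odometer = coins"
proof (rule measure_eqI_residue)
  interpret prob_space coins by (rule prob_space_coins)
  show "finite_measure (distr coins coins odometer)" "finite_measure coins"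
    by (auto intro!: finite_measure_distr finite_measure_axioms)
  fix n r :: nat assume r: "r < 2 ^ n"
\<comment> \<open>The predecessor of \<open>r\<close> modulo \<open>2 ^ n\<close>.\<close>
  define s where "s = (r + (2 ^ n - 1)) mod 2 ^ n"
  have s: "s < 2 ^ n" by (simp add: s_def)
  have "(t + 1) mod 2 ^ n = r \<longleftrightarrow> t = s" if t: "t < 2 ^ n" for t
  proof -
    consider "t + 1 = 2 ^ n" | "t + 1 < 2 ^ n" using t by linarith
    then show ?thesis
    proof cases
      case 1
      then show ?thesis using r s by (cases r) (auto simp: s_def)
    next
      case 2
      then show ?thesis using r s by (cases r) (auto simp: s_def)
    qed
  qed
  then have "odometer -` {w. residue n w = r} = {w. residue n w = s}"
    using residue_less by (auto simp: residue_odometer)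
  then show "measure (distr coins coins odometer) {w. residue n w = r} = measure coins {w. residue n w = r}"
    using r s by (simp add: measure_distr residue_set measure_residue)
qed auto

text \<open>
  The odometer permutes the residue classes modulo \<open>2 ^ n\<close> cyclically, so an invariant set \<open>B\<close> meets
  all of them in equal measure. Hence restricting the coin measure to \<open>B\<close> only rescales it, and
  evaluating both sides at \<open>B\<close> gives \<open>P(B) = P(B)\<^sup>2\<close>.
\<close>
lemma odometer_ergodic:
  assumes B: "B \<in> sets coins" and inv: "odometer -` B = B"
  shows "measure coins B = 0 \<or> measure coins B = 1"
proof -
  interpret prob_space coins by (rule prob_space_coins)
  have cyl: "prob (B \<inter> {w. residue n w = r}) = prob B / 2 ^ n" if "r < 2 ^ n" for n r
  proof -
    have step: "prob (B \<inter> {w. residue n w = Suc r}) = prob (B \<inter> {w. residue n w = r})" if "Suc r < 2 ^ n" for r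
    proof -
      have "odometer w \<in> B \<longleftrightarrow> w \<in> B" for w using inv by auto
      moreover have "residue n (odometer w) = Suc r \<longleftrightarrow> residue n w = r" for w
        using that residue_less[of n w] by (cases "residue n w + 1 = 2 ^ n") (auto simp: residue_odometer)
      ultimately have "B \<inter> {w. residue n w = r} = odometer -` (B \<inter> {w. residue n w = Suc r}) \<inter> space coins"
        by auto
      then have "prob (B \<inter> {w. residue n w = r}) = measure (distr coins coins odometer) (B \<inter> {w. residue n w = Suc r})"
        using B by (simp add: measure_distr residue_set)
      then show ?thesis by (simp add: distr_odometer)
    qed
    have const: "prob (B \<inter> {w. residue n w = r}) = prob (B \<inter> {w. residue n w = 0})" if "r < 2 ^ n" for r
      using that by (induction r) (use step in auto)
    have "prob B = prob (\<Union>r<2^n. B \<inter> {w. residue n w = r})"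
      by (rule arg_cong[of _ _ prob]) (auto simp: residue_less)
    also have "\<dots> = (\<Sum>r<2^n. prob (B \<inter> {w. residue n w = r}))"
      by (rule finite_measure_finite_Union)
         (auto simp: disjoint_family_on_def B residue_set)
    also have "\<dots> = (\<Sum>r<(2::nat)^n. prob (B \<inter> {w. residue n w = 0}))"
      by (intro sum.cong refl const) simp
    finally have "prob B = 2 ^ n * prob (B \<inter> {w. residue n w = 0})" by simp
    then show ?thesis using const[OF that] by simp
  qed
  let ?M = "density coins (indicator B)" and ?N = "scale_measure (ennreal (prob B)) coins"
  have eM: "emeasure ?M A = emeasure coins (B \<inter> A)" if "A \<in> sets coins" for A
    using that B by (simp add: emeasure_restricted)
  have eq: "?M = ?N"
  proof (rule measure_eqI_residue)
    show "finite_measure ?M" by (rule finite_measureI) (simp add: eM[of UNIV] emeasure_eq_measure sets.top[of coins, simplified])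
    show "finite_measure ?N" by (rule finite_measureI) (simp add: emeasure_eq_measure ennreal_mult_eq_top_iff)
    fix n r :: nat assume "r < 2 ^ n"
    then show "measure ?M {w. residue n w = r} = measure ?N {w. residue n w = r}"
      using cyl[of r n] measure_residue[of r n]
      by (simp add: measure_def eM residue_set) (simp add: measure_def[symmetric] enn2real_mult)
  qed auto
  have "ennreal (prob B) = emeasure ?M B" using eM[OF B] by (simp add: emeasure_eq_measure)
  also have "\<dots> = ennreal (prob B * prob B)" unfolding eq by (simp add: emeasure_eq_measure ennreal_mult)
  finally have "prob B = prob B * prob B" by (subst (asm) ennreal_inj) auto
  then show ?thesis by (cases "prob B = 0") auto
qed

section \<open>Processes coded by the odometer\<close>

definition coding :: "((nat \<Rightarrow> bool) \<Rightarrow> 'b) \<Rightarrow> (nat \<Rightarrow> bool) \<Rightarrow> nat \<Rightarrow> 'b" where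
  "coding s w = (\<lambda>n. s ((odometer ^^ n) w))"

definition coding_measure :: "((nat \<Rightarrow> bool) \<Rightarrow> 'b::topological_space) \<Rightarrow> (nat \<Rightarrow> 'b) measure" where
  "coding_measure s = distr coins borel (coding s)"

lemma shift_map_coding: "shift_map (coding s w) = coding s (odometer w)"
  by (simp add: shift_map_def coding_def funpow_swap1)

lemma measurable_odometer_funpow [measurable]: "odometer ^^ n \<in> measurable coins coins"
proof (induction n)
  case (Suc n)
  then show ?case using measurable_comp[OF Suc measurable_odometer] by simp
qed (simp add: id_def)

lemma distr_odometer_funpow: "distr coins coins (odometer ^^ n) = coins"
proof (induction n)
  case (Suc n)
  have "distr coins coins (odometer ^^ Suc n) = distr (distr coins coins (odometer ^^ n)) coins odometer"
    by (subst distr_distr) auto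
  then show ?case by (simp only: Suc distr_odometer)
qed (simp add: id_def distr_id)

lemma measurable_coding_component:
  assumes [measurable]: "s \<in> measurable coins (count_space UNIV)"
  shows "(\<lambda>w. coding s w n) \<in> measurable coins (count_space UNIV)"
  unfolding coding_def by measurable

lemma measurable_coding_pair:
  fixes s :: "(nat \<Rightarrow> bool) \<Rightarrow> 'b::{finite,discrete_topology}"
  assumes "s \<in> measurable coins (count_space UNIV)" "t \<in> measurable coins (count_space UNIV)"
  shows "(\<lambda>w. (coding s w, coding t w :: nat \<Rightarrow> 'b)) \<in> borel_measurable coins"
  by (intro measurable_pair_of_sequences measurable_coding_component assms)

lemma measurable_coding:
  fixes s :: "(nat \<Rightarrow> bool) \<Rightarrow> 'b::{finite,discrete_topology}"
  assumes "s \<in> measurable coins (count_space UNIV)"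
  shows "coding s \<in> borel_measurable coins"
  using measurable_comp[OF measurable_coding_pair[OF assms assms] borel_measurable_fst] by (simp add: comp_def)

lemma emeasure_coding_measure:
  fixes s :: "(nat \<Rightarrow> bool) \<Rightarrow> 'b::{finite,discrete_topology}"
  assumes "s \<in> measurable coins (count_space UNIV)" "B \<in> sets borel"
  shows "emeasure (coding_measure s) B = emeasure coins (coding s -` B)"
  unfolding coding_measure_def using emeasure_distr[OF measurable_coding[OF assms(1)] assms(2)] by simp

lemma coding_measure_invariant:
  fixes s :: "(nat \<Rightarrow> bool) \<Rightarrow> 'b::{finite,discrete_topology}"
  assumes s: "s \<in> measurable coins (count_space UNIV)"
    and X: "X \<in> sets borel" "\<And>w. coding s w \<in> X"
  shows "coding_measure s \<in> invariant_measures X"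
proof -
  interpret prob_space coins by (rule prob_space_coins)
  note [measurable] = measurable_coding[OF s]
  have "distr (coding_measure s) borel shift_map = distr coins borel (\<lambda>w. coding s (odometer w))"
    unfolding coding_measure_def by (subst distr_distr) (auto simp: comp_def shift_map_coding)
  also have "\<dots> = distr (distr coins coins odometer) borel (coding s)"
    by (subst distr_distr) (auto simp: comp_def)
  finally have "distr (coding_measure s) borel shift_map = coding_measure s"
    by (simp add: distr_odometer coding_measure_def)
  moreover have "prob_space (coding_measure s)"
    unfolding coding_measure_def by (rule prob_space_distr) measurable
  moreover have "coding s -` X = UNIV" using X(2) by auto
  then have "emeasure (coding_measure s) X = 1"
    using emeasure_space_1 by (simp add: emeasure_coding_measure[OF s X(1)])
  ultimately show ?thesis by (simp add: invariant_measures_def coding_measure_def)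
qed

lemma coding_measure_ergodic:
  fixes s :: "(nat \<Rightarrow> bool) \<Rightarrow> 'b::{finite,discrete_topology}"
  assumes s: "s \<in> measurable coins (count_space UNIV)"
  shows "coding_measure s \<in> ergodic_measures UNIV"
  unfolding ergodic_measures_def
proof (intro CollectI conjI ballI impI)
  show "coding_measure s \<in> invariant_measures UNIV"
    by (rule coding_measure_invariant[OF s]) auto
  interpret prob_space coins by (rule prob_space_coins)
  fix B :: "(nat \<Rightarrow> 'b) set" assume B: "B \<in> sets borel" "shift_map -` B = B"
  have "odometer -` coding s -` B = coding s -` (shift_map -` B)"
    by (auto simp: shift_map_coding)
  then have "prob (coding s -` B) = 0 \<or> prob (coding s -` B) = 1"
    using odometer_ergodic measurable_sets[OF measurable_coding[OF s] B(1)] B(2) by simp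
  then show "emeasure (coding_measure s) B = 0 \<or> emeasure (coding_measure s) B = 1"
    by (auto simp: emeasure_coding_measure[OF s B(1)] emeasure_eq_measure)
qed

text \<open>
  The joining is the joint law of the two codings along the same odometer orbit.
\<close>
lemma dbar_coding_le:
  fixes s :: "(nat \<Rightarrow> bool) \<Rightarrow> 'b::{finite,discrete_topology}"
  assumes s: "s \<in> measurable coins (count_space UNIV)" and t: "t \<in> measurable coins (count_space UNIV)"
  shows "dbar (coding_measure s) (coding_measure t) \<le> emeasure coins {w. s w \<noteq> t w}"
proof -
  interpret prob_space coins by (rule prob_space_coins)
  note [measurable] = measurable_coding_pair[OF s t] borel_measurable_fst borel_measurable_snd
  define \<xi> where "\<xi> = distr coins borel (\<lambda>w. (coding s w, coding t w))"
  have "distr \<xi> borel (map_prod shift_map shift_map)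
      = distr coins borel (\<lambda>w. (coding s (odometer w), coding t (odometer w)))"
    unfolding \<xi>_def by (subst distr_distr) (auto simp: comp_def shift_map_coding)
  also have "\<dots> = distr (distr coins coins odometer) borel (\<lambda>w. (coding s w, coding t w))"
    by (subst distr_distr) (auto simp: comp_def)
  finally have "distr \<xi> borel (map_prod shift_map shift_map) = \<xi>"
    by (simp add: distr_odometer \<xi>_def)
  moreover have "prob_space \<xi>" unfolding \<xi>_def by (rule prob_space_distr) measurable
  moreover have "distr \<xi> borel fst = coding_measure s" "distr \<xi> borel snd = coding_measure t"
    unfolding \<xi>_def coding_measure_def by (subst distr_distr; simp add: comp_def)+
  ultimately have "\<xi> \<in> joinings (coding_measure s) (coding_measure t)"
    by (simp add: joinings_def \<xi>_def)
  then have "dbar (coding_measure s) (coding_measure t) \<le> emeasure \<xi> {(x, y). x 0 \<noteq> y 0}"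
    unfolding dbar_def by (rule INF_lower)
  also have "\<dots> = emeasure coins {w. s w \<noteq> t w}"
    unfolding \<xi>_def emeasure_distr[OF measurable_coding_pair[OF s t] borel_first_symbols_differ]
    by (simp add: coding_def vimage_def)
  finally show ?thesis .
qed

section \<open>Superimposing all words\<close>

text \<open>
  The word \<open>W k\<close> is written at level \<open>level W k\<close>, where it covers at most the proportion
  \<open>1 / 2 ^ excess W k\<close> of all places. The recursion says
  \<open>excess W (Suc k) = level W k + length (W k) + 2\<close>: all later words together are then unlikely
  to damage any of the \<open>length (W k)\<close> places of a copy of \<open>W k\<close>, even compared with the probability
  \<open>1 / 2 ^ level W k\<close> of seeing such a copy start.
\<close>
primrec excess :: "(nat \<Rightarrow> 'a list) \<Rightarrow> nat \<Rightarrow> nat" where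
  "excess W 0 = 0"
| "excess W (Suc k) = excess W k + 2 * length (W k) + 2"

definition level :: "(nat \<Rightarrow> 'a list) \<Rightarrow> nat \<Rightarrow> nat" where
  "level W k = excess W k + length (W k)"

text \<open>
  The periodic sequence after \<open>k\<close> stages; each stage overwrites the earlier ones. The initial symbol
  is arbitrary.
\<close>
primrec fill :: "(nat \<Rightarrow> 'a list) \<Rightarrow> nat \<Rightarrow> nat \<Rightarrow> 'a" where
  "fill W 0 m = undefined"
| "fill W (Suc k) m = (if m mod 2 ^ level W k < length (W k) then W k ! (m mod 2 ^ level W k) else fill W k m)"

definition symbol :: "(nat \<Rightarrow> 'a list) \<Rightarrow> nat \<Rightarrow> (nat \<Rightarrow> bool) \<Rightarrow> 'a" where
  "symbol W k w = fill W k (residue (level W k) w)"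

definition hit :: "(nat \<Rightarrow> 'a list) \<Rightarrow> nat \<Rightarrow> (nat \<Rightarrow> bool) set" where
  "hit W k = {w. residue (level W k) w < length (W k)}"

definition late_hit :: "(nat \<Rightarrow> 'a list) \<Rightarrow> nat \<Rightarrow> (nat \<Rightarrow> bool) set" where
  "late_hit W k = (\<Union>j. hit W (k + j))"

text \<open>
  The symbol at the first stage after which nothing is overwritten. On the null set where there is
  no such stage the value is an arbitrary measurable choice.
\<close>
definition limit_symbol :: "(nat \<Rightarrow> 'a list) \<Rightarrow> (nat \<Rightarrow> bool) \<Rightarrow> 'a" where
  "limit_symbol W w = symbol W (LEAST k. w \<notin> late_hit W k) w"

lemma level_Suc: "level W k \<le> level W (Suc k)"
  by (simp add: level_def)

lemma level_mono: "k \<le> j \<Longrightarrow> level W k \<le> level W j"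
  by (rule lift_Suc_mono_le[of "level W", OF level_Suc])

lemma excess_add: "excess W k + j \<le> excess W (k + j)"
  by (induction j) auto

lemma length_less_level: "length (W k) < 2 ^ level W k"
proof -
  have "length (W k) < 2 ^ length (W k)" by (rule less_exp)
  also have "\<dots> \<le> 2 ^ level W k" by (rule power_increasing) (simp_all add: level_def)
  finally show ?thesis .
qed

text \<open>
  Levels increase, so stages up to \<open>Suc j\<close> see only residues modulo divisors of \<open>2 ^ level W j\<close>.
\<close>
lemma fill_mod:
  assumes "k \<le> Suc j"
  shows "fill W k (m mod 2 ^ level W j) = fill W k m"
  using assms
proof (induction k)
  case (Suc k)
  then have "2 ^ level W k dvd (2 :: nat) ^ level W j" by (intro le_imp_power_dvd level_mono) simp
  then show ?case using Suc by (simp add: mod_mod_cancel)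
qed simp

lemma fill_periodic: "fill W k (n + 2 ^ level W k) = fill W k n"
  using fill_mod[of k k W "n + 2 ^ level W k"] fill_mod[of k k W n] by simp

lemma symbol_hit:
  assumes "residue (level W k) w < length (W k)"
  shows "symbol W (Suc k) w = W k ! residue (level W k) w"
  using assms residue_mod[OF level_Suc[of W k], of w] by (simp add: symbol_def)

lemma symbol_Suc:
  assumes "w \<notin> hit W k"
  shows "symbol W (Suc k) w = symbol W k w"
  using assms residue_mod[OF level_Suc[of W k], of w] fill_mod[of k k W "residue (level W (Suc k)) w"]
  by (simp add: symbol_def hit_def)

lemma limit_symbol_eq:
  assumes "w \<notin> late_hit W k"
  shows "limit_symbol W w = symbol W k w"
proof -
  define m where "m = (LEAST k. w \<notin> late_hit W k)"
  have m: "w \<notin> late_hit W m" "m \<le> k"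
    unfolding m_def
    using assms LeastI[of "\<lambda>k. w \<notin> late_hit W k"] Least_le[of "\<lambda>k. w \<notin> late_hit W k"] by auto
  have "symbol W (m + j) w = symbol W m w" for j
    using m(1) symbol_Suc[of w W] by (induction j) (auto simp: late_hit_def)
  from this[of "k - m"] show ?thesis
    using m(2) by (simp add: limit_symbol_def m_def)
qed

lemma measurable_symbol [measurable]: "symbol W k \<in> measurable coins (count_space UNIV)"
  unfolding symbol_def by measurable

lemma hit_measurable [measurable]: "hit W k \<in> sets coins"
proof -
  have "{w \<in> space coins. residue (level W k) w < length (W k)} \<in> sets coins" by measurable
  then show ?thesis by (simp add: hit_def)
qed

lemma late_hit_measurable [measurable]: "late_hit W k \<in> sets coins"
  unfolding late_hit_def by measurable

lemma measurable_limit_symbol: "limit_symbol W \<in> measurable coins (count_space UNIV)"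
  unfolding limit_symbol_def
  by (rule measurable_compose_countable[OF measurable_symbol]) measurable

lemma measure_hit_le: "measure coins (hit W k) \<le> 1 / 2 ^ excess W k"
proof -
  interpret prob_space coins by (rule prob_space_coins)
  have "prob (hit W k) \<le> prob (\<Union>r<length (W k). {w. residue (level W k) w = r})"
    by (intro finite_measure_mono) (auto simp: hit_def residue_set)
  also have "\<dots> \<le> (\<Sum>r<length (W k). prob {w. residue (level W k) w = r})"
    by (intro finite_measure_subadditive_finite) (auto simp: residue_set)
  also have "\<dots> = (\<Sum>r<length (W k). 1 / 2 ^ level W k)"
    using length_less_level[of W k] by (intro sum.cong) (auto simp: measure_residue)
  also have "\<dots> = real (length (W k)) / 2 ^ length (W k) * (1 / 2 ^ excess W k)"
    by (simp add: level_def power_add)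
  also have "\<dots> \<le> 1 * (1 / 2 ^ excess W k)"
    by (intro mult_right_mono) (simp_all add: less_imp_le[OF of_nat_less_two_power])
  finally show ?thesis by simp
qed

text \<open>
  The excesses grow by at least \<open>1\<close> per stage, so a geometric series bounds the union.
\<close>
lemma measure_late_hit_le: "measure coins (late_hit W k) \<le> 2 / 2 ^ excess W k"
proof -
  interpret prob_space coins by (rule prob_space_coins)
  have le: "prob (hit W (k + j)) \<le> 1 / 2 ^ excess W k * (1 / 2) ^ j" for j
  proof -
    have "prob (hit W (k + j)) \<le> (1 / 2) ^ excess W (k + j)"
      using measure_hit_le[of W "k + j"] by (simp add: power_one_over)
    also have "\<dots> \<le> (1 / 2) ^ (excess W k + j)"
      using excess_add by (intro power_decreasing) auto
    finally show ?thesis by (simp add: power_add power_one_over)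
  qed
  have sums: "(\<lambda>j. 1 / 2 ^ excess W k * (1 / 2) ^ j) sums (1 / 2 ^ excess W k * 2 :: real)"
    using sums_mult[OF geometric_sums[of "1/2::real"], of "1 / 2 ^ excess W k"] by simp
  have summ: "summable (\<lambda>j. prob (hit W (k + j)))"
    by (rule summable_comparison_test'[OF sums_summable[OF sums]]) (use le in auto)
  have "prob (late_hit W k) \<le> (\<Sum>j. prob (hit W (k + j)))"
    unfolding late_hit_def by (rule finite_measure_subadditive_countably[OF _ summ]) auto
  also have "\<dots> \<le> 1 / 2 ^ excess W k * 2"
    using suminf_le[OF le summ sums_summable[OF sums]] sums_unique[OF sums] by simp
  finally show ?thesis by simp
qed

text \<open>
  Start at residue \<open>0\<close> modulo \<open>2 ^ level W k\<close>, so that stage \<open>k\<close> writes the word \<open>W k\<close> on the next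
  places, and discard the starting points where one of these places is overwritten later. By the
  choice of the excess, the discarded part has less measure than the residue class.
\<close>
lemma limit_symbol_word_probability:
  "emeasure coins {w. \<forall>i<length (W k). limit_symbol W ((odometer ^^ i) w) = W k ! i} > 0"
proof -
  interpret prob_space coins by (rule prob_space_coins)
  let ?L = "length (W k)"
  define R where "R = {w. residue (level W k) w = 0}"
  define Q where "Q = (\<Union>i<?L. (odometer ^^ i) -` late_hit W (Suc k))"
  define G where "G = {w. \<forall>i<?L. limit_symbol W ((odometer ^^ i) w) = W k ! i}"
  have pre: "(odometer ^^ i) -` late_hit W (Suc k) \<in> sets coins" for i
    using measurable_sets[OF measurable_odometer_funpow late_hit_measurable] by simp
  then have [measurable]: "Q \<in> sets coins" by (auto simp: Q_def)
  have [measurable]: "R \<in> sets coins" by (simp add: R_def residue_set)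
  note [measurable] = measurable_limit_symbol
  have "{w \<in> space coins. \<forall>i<?L. limit_symbol W ((odometer ^^ i) w) = W k ! i} \<in> sets coins" by measurable
  then have G: "G \<in> sets coins" by (simp add: G_def)
  have "R - Q \<subseteq> G"
  proof
    fix w assume w: "w \<in> R - Q"
    show "w \<in> G" unfolding G_def
    proof (intro CollectI allI impI)
      fix i assume i: "i < ?L"
      have r: "residue (level W k) ((odometer ^^ i) w) = i"
        using w i length_less_level[of W k] by (simp add: R_def residue_odometer_funpow)
      have "(odometer ^^ i) w \<notin> late_hit W (Suc k)" using w i by (auto simp: Q_def)
      then show "limit_symbol W ((odometer ^^ i) w) = W k ! i"
        using symbol_hit[of W k "(odometer ^^ i) w"] r i by (simp add: limit_symbol_eq)
    qed
  qed
  then have "prob (R - Q) \<le> prob G" using G by (intro finite_measure_mono) auto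
  moreover have "prob R \<le> prob (R - Q) + prob Q"
    using measure_Un_le[of "R - Q" coins Q] finite_measure_mono[of R "(R - Q) \<union> Q"] by auto
  moreover have "prob Q < prob R"
  proof -
    have "prob ((odometer ^^ i) -` late_hit W (Suc k)) = prob (late_hit W (Suc k))" for i
    proof -
      have "prob ((odometer ^^ i) -` late_hit W (Suc k)) = measure (distr coins coins (odometer ^^ i)) (late_hit W (Suc k))"
        by (subst measure_distr) auto
      then show ?thesis by (simp add: distr_odometer_funpow)
    qed
    then have "prob Q \<le> (\<Sum>i<?L. prob (late_hit W (Suc k)))"
      using finite_measure_subadditive_finite[of "{..<?L}" "\<lambda>i. (odometer ^^ i) -` late_hit W (Suc k)"] pre
      by (auto simp: Q_def)
    also have "\<dots> \<le> ?L * (2 / 2 ^ excess W (Suc k))"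
      using mult_left_mono[OF measure_late_hit_le[of W "Suc k"], of "real ?L"] by (simp del: excess.simps)
    also have "\<dots> = (?L / 2 ^ ?L) * (1 / 2 ^ level W k) / 2"
    proof -
      have "excess W (Suc k) = level W k + ?L + 2" by (simp add: level_def)
      then show ?thesis by (simp add: power_add del: excess.simps)
    qed
    also have "\<dots> \<le> 1 * (1 / 2 ^ level W k) / 2"
      by (intro divide_right_mono mult_right_mono) (simp_all add: less_imp_le[OF of_nat_less_two_power])
    also have "\<dots> < 1 / 2 ^ level W k" by (simp add: divide_less_eq)
    finally show ?thesis by (simp add: R_def measure_residue)
  qed
  ultimately have "prob G > 0" by linarith
  then show ?thesis by (simp add: G_def emeasure_eq_measure)
qed

text \<open>
  The starting point of the sample path on the orbit is its residue.
\<close>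
lemma coding_symbol_in_orbit: "coding (symbol W k) w \<in> orbit (fill W k)"
proof -
  have "coding (symbol W k) w = (\<lambda>n. fill W k (n + residue (level W k) w))"
    by (simp add: coding_def symbol_def residue_odometer_funpow fill_mod add.commute)
  then show ?thesis by (auto simp: orbit_def)
qed

lemma fully_supported_limit:
  fixes W :: "nat \<Rightarrow> 'b::{finite,discrete_topology} list"
  assumes "surj W"
  shows "fully_supported (coding_measure (limit_symbol W))"
  unfolding fully_supported_def
proof (intro allI impI, elim conjE)
  fix U :: "(nat \<Rightarrow> 'b) set" assume U: "open U" "U \<noteq> {}"
  then obtain x where "x \<in> U" by auto
  then obtain n where n: "{y. \<forall>i<n. y i = x i} \<subseteq> U"
    by (rule open_contains_cylinder[OF U(1)])
  obtain k where k: "W k = map x [0..<n]" using surjD[OF assms, of "map x [0..<n]"] by metis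
  have "0 < emeasure coins {w. \<forall>i<length (W k). limit_symbol W ((odometer ^^ i) w) = W k ! i}"
    by (rule limit_symbol_word_probability)
  also have "\<dots> \<le> emeasure coins (coding (limit_symbol W) -` U)"
  proof (rule emeasure_mono)
    show "{w. \<forall>i<length (W k). limit_symbol W ((odometer ^^ i) w) = W k ! i} \<subseteq> coding (limit_symbol W) -` U"
      using n by (auto simp: k coding_def)
    show "coding (limit_symbol W) -` U \<in> sets coins"
      using measurable_sets[OF measurable_coding[OF measurable_limit_symbol] borel_open[OF U(1)]] by simp
  qed
  also have "\<dots> = emeasure (coding_measure (limit_symbol W)) U"
    using U(1) by (simp add: emeasure_coding_measure measurable_limit_symbol)
  finally show "0 < emeasure (coding_measure (limit_symbol W)) U" .
qed

text \<open>
  A closed set of full measure must be the whole space, where the point mass at a constant sequence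
  is another invariant measure.
\<close>
lemma fully_supported_not_unique:
  fixes \<mu> :: "(nat \<Rightarrow> 'b::discrete_topology) measure"
  assumes supp: "fully_supported \<mu>" and "CARD('b) \<ge> 2" and X: "shift_space X" "invariant_measures X = {\<mu>}"
  shows False
proof -
  have \<mu>: "\<mu> \<in> invariant_measures X" using X by simp
  interpret prob_space \<mu> using \<mu> by (simp add: invariant_measures_def)
  have sets: "sets \<mu> = sets borel" and "emeasure \<mu> X = 1" using \<mu> by (auto simp: invariant_measures_def)
  have [simp]: "space \<mu> = UNIV" using sets_eq_imp_space_eq[OF sets] by simp
  have "closed X" using X by (simp add: shift_space_def)
  then have "emeasure \<mu> (- X) = 0"
    using \<open>emeasure \<mu> X = 1\<close> prob_compl[of X] sets by (simp add: emeasure_eq_measure Compl_eq_Diff_UNIV)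
  then have "X = UNIV" using supp \<open>closed X\<close> by (auto simp: fully_supported_def closed_def)
  obtain a b :: 'b where "a \<noteq> b"
    using assms(2) card_le_Suc0_iff_eq[of "UNIV :: 'b set"] card.infinite[of "UNIV :: 'b set"] by fastforce
  define \<delta> where "\<delta> = return borel (\<lambda>_::nat. a)"
  have "prob_space \<delta>" unfolding \<delta>_def by (rule prob_space_return) simp
  moreover have "distr \<delta> borel shift_map = \<delta>"
    unfolding \<delta>_def by (subst distr_return[OF measurable_shift_map]) (auto simp: shift_map_def)
  ultimately have "\<delta> \<in> invariant_measures X"
    using \<open>X = UNIV\<close> by (simp add: invariant_measures_def \<delta>_def)
  then have "\<mu> = \<delta>" using X by auto
  have op: "open {x::nat \<Rightarrow> 'b. x 0 \<in> {b}}" by (rule open_first_symbol)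
  then have "emeasure \<delta> {x. x 0 \<in> {b}} = 0"
    using \<open>a \<noteq> b\<close> by (simp add: \<delta>_def emeasure_return borel_open)
  moreover have "(\<lambda>_. b) \<in> {x::nat \<Rightarrow> 'b. x 0 \<in> {b}}" by simp
  ultimately show False
    using supp op \<open>\<mu> = \<delta>\<close> unfolding fully_supported_def by (metis empty_iff less_irrefl)
qed

theorem proposition13:
  assumes "CARD('a::{finite, discrete_topology}) \<ge> 2"
  shows "\<exists>(X :: nat \<Rightarrow> (nat \<Rightarrow> 'a) set) (\<mu> :: (nat \<Rightarrow> 'a) measure).
    (\<forall>k\<ge>1. shift_space (X k) \<and> finite (X k) \<and> transitive_shift (X k)) \<and>
    \<mu> \<in> ergodic_measures UNIV \<and> fully_supported \<mu> \<and>
    (\<lambda>k. dbar_Hausdorff (invariant_measures (X k)) {\<mu>}) \<longlonglongrightarrow> 0 \<and>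
    \<not> (\<exists>Y :: (nat \<Rightarrow> 'a) set. shift_space Y \<and> invariant_measures Y = {\<mu>})"
proof -
  interpret prob_space coins by (rule prob_space_coins)
  define W :: "nat \<Rightarrow> 'a list" where "W = from_nat"
  have "surj W" by (simp add: W_def)
  define X where "X k = orbit (fill W k)" for k
  define \<mu> where "\<mu> = coding_measure (limit_symbol W)"
  define \<nu> where "\<nu> k = coding_measure (symbol W k)" for k
  have per: "fill W k (n + 2 ^ level W k) = fill W k n" "(2::nat) ^ level W k > 0" for k n
    by (simp_all add: fill_periodic)
  have X: "shift_space (X k)" "finite (X k)" "transitive_shift (X k)" for k
    unfolding X_def using shift_space_orbit[of "fill W k", OF per] finite_orbit[of "fill W k", OF per]
      transitive_orbit[of "fill W k", OF per] by auto
  have "\<nu> k \<in> invariant_measures (X k)" for k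
    unfolding \<nu>_def using X(1)[of k]
    by (intro coding_measure_invariant measurable_symbol) (auto simp: X_def coding_symbol_in_orbit shift_space_def)
  then have inv: "invariant_measures (X k) = {\<nu> k}" for k
    using invariant_measure_orbit_unique[of "fill W k", OF per] unfolding X_def by blast
  have bound: "dbar (\<nu> k) \<mu> \<le> ennreal (2 * (1 / 2) ^ k)" for k
  proof -
    have "dbar (\<nu> k) \<mu> \<le> emeasure coins {w. symbol W k w \<noteq> limit_symbol W w}"
      unfolding \<nu>_def \<mu>_def by (intro dbar_coding_le measurable_symbol measurable_limit_symbol)
    also have "\<dots> \<le> emeasure coins (late_hit W k)"
      using limit_symbol_eq[of _ W k] by (intro emeasure_mono subsetI late_hit_measurable) fastforce
    also have "\<dots> \<le> ennreal (2 * (1 / 2) ^ excess W k)"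
      using measure_late_hit_le[of W k] by (simp add: emeasure_eq_measure power_one_over ennreal_leI)
    also have "\<dots> \<le> ennreal (2 * (1 / 2) ^ k)"
      using excess_add[of W 0 k] by (intro ennreal_leI mult_left_mono power_decreasing) auto
    finally show ?thesis .
  qed
  have "(\<lambda>k. ennreal (2 * (1 / 2) ^ k)) \<longlonglongrightarrow> ennreal (2 * 0)"
    by (intro tendsto_ennrealI tendsto_mult tendsto_const LIMSEQ_power_zero) simp
  then have "(\<lambda>k. ennreal (2 * (1 / 2) ^ k)) \<longlonglongrightarrow> 0"
    by simp
  then have "(\<lambda>k. dbar (\<nu> k) \<mu>) \<longlonglongrightarrow> 0"
    by (rule tendsto_sandwich[OF always_eventually always_eventually tendsto_const, rotated 2])
      (simp_all add: bound)
  then have lim: "(\<lambda>k. dbar_Hausdorff (invariant_measures (X k)) {\<mu>}) \<longlonglongrightarrow> 0"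
    by (simp add: dbar_Hausdorff_def inv)
  have supp: "fully_supported \<mu>"
    unfolding \<mu>_def by (rule fully_supported_limit[OF \<open>surj W\<close>])
  have "\<mu> \<in> ergodic_measures UNIV"
    unfolding \<mu>_def by (rule coding_measure_ergodic[OF measurable_limit_symbol])
  moreover have "\<not> (\<exists>Y. shift_space Y \<and> invariant_measures Y = {\<mu>})"
    using fully_supported_not_unique[OF supp assms] by blast
  ultimately show ?thesis using X lim supp by blast
qed

end
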